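(* Let $n\ge1$, $k\ge0$ be integers with $\gcd(n,k)=1$, let $C_n$ be the cycle graph with vertices $v_1,\dots,v_n$ in cyclic order, $q=v_n$, $j\in\{1,\dots,n\}$ and $D_j=v_j-q$. For an effective divisor $E\in\mathbb{N}^n$ of degree $k$ let $N_E=[bw^{E(v_1)}bw^{E(v_2)}\cdots bw^{E(v_n)}]\in\mathcal{N}(n,k)$. Then the map $\psi:|D_j+kq|\to\mathcal{N}(n,k)$, $E\mapsto N_E$, is a bijection.
   Context: Divisors on $C_n$ are vectors in $\mathbb{Z}^n$ indexed by the vertices; $\deg E=\sum_iE(v_i)$; $L$ is the Laplacian matrix of $C_n$; $D\sim D'$ iff $D-D'\in\operatorname{im}_\mathbb{Z}L$; $|D|=\{E\in\mathbb{Z}^n:E\ge0,E\sim D\}$. A binary necklace is an equivalence class of words in the letters $b$ (black), $w$ (white) modulo cyclic shifts; $\mathcal{N}(n,k)$ is the set of binary necklaces with $n$ black and $k$ white beads; $[u]$ denotes the necklace of the word $u$, and $w^a$ denotes $a$ consecutive white beads. *)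

theory Defs
  imports "Jordan_Normal_Form.Matrix"
begin

text \<open>
  A finite multigraph on the vertices \<open>0, \<dots>, n - 1\<close> is given by \<open>n\<close> and the list of its edges,
  each oriented arbitrarily.  A loop contributes 2 both to the degree of its vertex and to the
  diagonal entry of the adjacency matrix, so it does not affect the Laplacian.
\<close>

type_synonym edge = "nat \<times> nat"

definition vertex_degree :: "edge list \<Rightarrow> nat \<Rightarrow> nat" where
  "vertex_degree es u = count_list (map fst es) u + count_list (map snd es) u"

definition adjacency :: "edge list \<Rightarrow> nat \<Rightarrow> nat \<Rightarrow> nat" where
  "adjacency es u v = count_list es (u, v) + count_list es (v, u)"

definition laplacian :: "nat \<Rightarrow> edge list \<Rightarrow> int mat" where
  "laplacian n es =
     mat n n (\<lambda>(u, v). (if u = v then int (vertex_degree es u) else 0) - int (adjacency es u v))"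

text \<open>
  For \<open>n = 2\<close> the cycle consists of two parallel edges, for \<open>n = 1\<close> of a single loop.
\<close>

definition cycle_edges :: "nat \<Rightarrow> edge list" where
  "cycle_edges n = map (\<lambda>i. (i, Suc i mod n)) [0..<n]"

definition cycle_laplacian :: "nat \<Rightarrow> int mat" where
  "cycle_laplacian n = laplacian n (cycle_edges n)"

text \<open>
  Divisors are integer vectors of dimension \<open>n\<close>.  The vertices \<open>v\<^sub>1, \<dots>, v\<^sub>n\<close> are numbered from 1,
  the entries of a vector from 0, so \<open>E(v\<^sub>i)\<close> is the entry of \<open>E\<close> at \<open>i - 1\<close>.
\<close>

definition vertex_divisor :: "nat \<Rightarrow> nat \<Rightarrow> int vec" where
  "vertex_divisor n i = unit_vec n (i - 1)"

definition lin_equiv :: "nat \<Rightarrow> int vec \<Rightarrow> int vec \<Rightarrow> bool" where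
  "lin_equiv n D D' \<longleftrightarrow> D - D' \<in> (\<lambda>z. cycle_laplacian n *\<^sub>v z) ` carrier_vec n"

definition linear_system :: "nat \<Rightarrow> int vec \<Rightarrow> int vec set" where
  "linear_system n D = {E \<in> carrier_vec n. 0\<^sub>v n \<le> E \<and> lin_equiv n E D}"

datatype bead = Black | White

definition cyclic_shift_rel :: "bead list rel" where
  "cyclic_shift_rel = {(u, v). \<exists>m. v = rotate m u}"

definition necklace :: "bead list \<Rightarrow> bead list set" where
  "necklace u = cyclic_shift_rel `` {u}"

definition necklaces :: "nat \<Rightarrow> nat \<Rightarrow> bead list set set" where
  "necklaces n k = {u. count_list u Black = n \<and> count_list u White = k} // cyclic_shift_rel"

text \<open>
  The conversion to \<^typ>\<open>nat\<close> is only meaningful for effective divisors.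
\<close>

definition divisor_word :: "int vec \<Rightarrow> bead list" where
  "divisor_word E =
     concat (map (\<lambda>i. Black # replicate (nat (E $ i)) White) [0..<dim_vec E])"

definition divisor_necklace :: "int vec \<Rightarrow> bead list set" where
  "divisor_necklace E = necklace (divisor_word E)"

end

theory Submission
  imports Defs "HOL-Number_Theory.Cong"
begin

text \<open>
  An integer vector \<open>F\<close> lies in the image of the Laplacian of \<open>C\<^sub>n\<close> iff its entries sum to \<open>0\<close> and
  its weight \<open>\<Sum>\<^sub>i i F\<^sub>i\<close> is divisible by \<open>n\<close>.  Hence \<open>|D|\<close> consists of the effective divisors of the
  same degree as \<open>D\<close> whose weight is congruent to that of \<open>D\<close> modulo \<open>n\<close>.  Two effective divisors
  give the same necklace iff they differ by a cyclic rotation, and rotating a divisor of degree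
  \<open>k\<close> by one step changes its weight by \<open>- k\<close> modulo \<open>n\<close>.  As \<open>k\<close> is a unit modulo \<open>n\<close>, each
  rotation orbit contains exactly one divisor of each weight class.
\<close>

section \<open>The image of the Laplacian of a cycle\<close>

lemma count_list_distinct:
  assumes "distinct xs"
  shows "count_list xs x = (if x \<in> set xs then 1 else 0)"
  using assms by (induction xs) auto

lemma bij_betw_Suc_mod:
  assumes "n \<ge> 1"
  shows "bij_betw (\<lambda>i. Suc i mod n) {..<n} {..<n}"
  by (rule bij_betw_byWitness[where f' = "\<lambda>i. if i = 0 then n - 1 else i - 1"])
    (use assms in \<open>auto simp: mod_Suc\<close>)

lemma Suc_mod_eq_iff:
  assumes "u < n" "v < n"
  shows "Suc v mod n = u \<longleftrightarrow> v = (if u = 0 then n - 1 else u - 1)"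
  using assms by (auto simp: mod_Suc)

text \<open>The successor map permutes the vertices, so each vertex is the source of exactly one
  edge and the target of exactly one. For \<open>n = 1\<close> the loop is counted at both
  ends.\<close>

lemma vertex_degree_cycle:
  assumes "u < n"
  shows "vertex_degree (cycle_edges n) u = 2"
proof -
  have bij: "bij_betw (\<lambda>i. Suc i mod n) {..<n} {..<n}"
    using assms by (intro bij_betw_Suc_mod) simp
  have "map snd (cycle_edges n) = map (\<lambda>i. Suc i mod n) [0..<n]"
    by (simp add: cycle_edges_def)
  moreover have "distinct (map (\<lambda>i. Suc i mod n) [0..<n])"
    using bij by (simp add: distinct_map bij_betw_def atLeast0LessThan)
  moreover have "set (map (\<lambda>i. Suc i mod n) [0..<n]) = {..<n}"
    using bij by (simp add: bij_betw_def atLeast0LessThan)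
  ultimately have "count_list (map snd (cycle_edges n)) u = 1"
    using assms by (simp add: count_list_distinct)
  moreover have "count_list (map fst (cycle_edges n)) u = 1"
    using assms by (simp add: cycle_edges_def comp_def count_list_distinct)
  ultimately show ?thesis
    by (simp add: vertex_degree_def)
qed

lemma count_list_cycle_edges:
  assumes "u < n"
  shows "count_list (cycle_edges n) (u, v) = (if v = Suc u mod n then 1 else 0)"
proof -
  have "distinct (cycle_edges n)"
    by (auto simp: cycle_edges_def distinct_map inj_on_def)
  then show ?thesis
    using assms by (auto simp: count_list_distinct cycle_edges_def)
qed

text \<open>The two neighbour indicators are subtracted separately because they may coincide: both
  fire off the diagonal for \<open>n = 2\<close> (double edge, entry -2) and on it for
  \<open>n = 1\<close> (loop, entry 0).\<close>

lemma cycle_laplacian_index: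
  assumes "u < n" "v < n"
  shows "cycle_laplacian n $$ (u, v) =
    (if u = v then 2 else 0) - (if v = Suc u mod n then 1 else 0) - (if u = Suc v mod n then 1 else 0)"
  using assms
  by (simp add: cycle_laplacian_def laplacian_def vertex_degree_cycle adjacency_def
      count_list_cycle_edges)

lemma cycle_laplacian_mult_index:
  assumes "u < n" "z \<in> carrier_vec n"
  shows "(cycle_laplacian n *\<^sub>v z) $ u =
    2 * z $ u - z $ (Suc u mod n) - z $ (if u = 0 then n - 1 else u - 1)"
proof -
  define p where "p = (if u = 0 then n - 1 else u - 1)"
  have p: "p < n" "Suc u mod n < n"
    using assms(1) by (auto simp: p_def)
  have p_iff: "u = Suc v mod n \<longleftrightarrow> v = p" if "v < n" for v
    using Suc_mod_eq_iff[OF assms(1) that] unfolding p_def by metis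
  have "(cycle_laplacian n *\<^sub>v z) $ u = (\<Sum>v<n. cycle_laplacian n $$ (u, v) * z $ v)"
    using assms
    by (simp add: scalar_prod_def cycle_laplacian_def laplacian_def atLeast0LessThan)
  also have "\<dots> = (\<Sum>v<n. (if v = u then 2 * z $ v else 0) - (if v = Suc u mod n then z $ v else 0)
      - (if v = p then z $ v else 0))"
    by (intro sum.cong refl)
      (simp add: cycle_laplacian_index[OF assms(1)] p_iff left_diff_distrib)
  also have "\<dots> = 2 * z $ u - z $ (Suc u mod n) - z $ p"
    using p assms(1) by (simp add: sum_subtractf)
  finally show ?thesis
    by (simp only: p_def)
qed

section \<open>Degree and weight as the invariants of linear equivalence\<close>

text \<open>On divisors of degree 0, the residue of this sum modulo \<open>n\<close> induces the
  isomorphism from the Jacobian group of the cycle to the integers modulo \<open>n\<close>.\<close>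

definition weight :: "int vec \<Rightarrow> int" where
  "weight E = (\<Sum>i<dim_vec E. int i * E $ i)"

definition degree :: "int vec \<Rightarrow> int" where
  "degree E = (\<Sum>i<dim_vec E. E $ i)"

text \<open>Summation by parts moves the symmetric Laplacian from \<open>z\<close> to the test
  function \<open>f\<close>. Indexing the result by successors expresses the second difference of
  \<open>f\<close> without predecessors.\<close>

lemma weighted_sum_cycle_laplacian:
  assumes "n \<ge> 1" "z \<in> carrier_vec n"
  shows "(\<Sum>u<n. f u * (cycle_laplacian n *\<^sub>v z) $ u) =
    (\<Sum>u<n. (2 * f (Suc u mod n) - f u - f (Suc (Suc u mod n) mod n)) * z $ (Suc u mod n))"
proof -
  let ?s = "\<lambda>u. Suc u mod n" and ?p = "\<lambda>u. if u = 0 then n - 1 else u - 1"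
  note reindex = sum.reindex_bij_betw[OF bij_betw_Suc_mod[OF assms(1)], symmetric]
  have p: "?p (?s u) = u" if "u < n" for u
    using that by (auto simp: mod_Suc)
  have "(\<Sum>u<n. f u * (cycle_laplacian n *\<^sub>v z) $ u) =
      (\<Sum>u<n. f u * (2 * z $ u)) - (\<Sum>u<n. f u * z $ ?s u) - (\<Sum>u<n. f u * z $ ?p u)"
    using assms(2)
    by (simp add: cycle_laplacian_mult_index right_diff_distrib sum_subtractf split del: if_split)
  also have "(\<Sum>u<n. f u * z $ ?p u) = (\<Sum>u<n. f (?s u) * z $ ?p (?s u))"
    by (rule reindex)
  also have "\<dots> = (\<Sum>u<n. f (?s u) * z $ u)"
    by (intro sum.cong refl) (simp only: p lessThan_iff)
  also have "\<dots> = (\<Sum>u<n. f (?s (?s u)) * z $ ?s u)"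
    by (rule reindex)
  also have "(\<Sum>u<n. f u * (2 * z $ u)) = (\<Sum>u<n. f (?s u) * (2 * z $ ?s u))"
    by (rule reindex)
  finally show ?thesis
    by (simp add: sum_subtractf[symmetric] algebra_simps)
qed

text \<open>Necessity comes from the test functions 1 and \<open>int\<close>: the second difference
  of the first is 0, that of the second is 0 modulo \<open>n\<close>, since the index grows by 1
  modulo \<open>n\<close> even across the wrap-around. Sufficiency comes from an explicit
  preimage.\<close>

lemma cycle_laplacian_image_iff:
  assumes n: "n \<ge> 1" and F: "F \<in> carrier_vec n"
  shows "F \<in> (\<lambda>z. cycle_laplacian n *\<^sub>v z) ` carrier_vec n \<longleftrightarrow>
    degree F = 0 \<and> int n dvd weight F"
proof
  assume "F \<in> (\<lambda>z. cycle_laplacian n *\<^sub>v z) ` carrier_vec n"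
  then obtain z where z: "z \<in> carrier_vec n" and Fz: "F = cycle_laplacian n *\<^sub>v z"
    by blast
  have "degree F = (\<Sum>u<n. 1 * F $ u)"
    using F by (simp add: degree_def)
  also have "\<dots> = 0"
    unfolding Fz using weighted_sum_cycle_laplacian[OF n z, of "\<lambda>_. 1"] by simp
  finally have "degree F = 0" .
  moreover have "int n dvd (\<Sum>u<n. (2 * int (Suc u mod n) - int u
      - int (Suc (Suc u mod n) mod n)) * z $ (Suc u mod n))"
  proof (intro dvd_sum dvd_mult2)
    fix u
    let ?s = "\<lambda>u. Suc u mod n"
    have s: "[int (?s u) = int u + 1] (mod int n)" for u
      by (simp add: cong_def zmod_int ac_simps)
    have "[2 * int (?s u) - int u - int (?s (?s u)) = 2 * int (?s u) - int u - (int (?s u) + 1)] (mod int n)"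
      by (intro cong_diff cong_refl s)
    also have "[2 * int (?s u) - int u - (int (?s u) + 1) = int (?s u) - (int u + 1)] (mod int n)"
      by (simp add: algebra_simps)
    also have "[int (?s u) - (int u + 1) = (int u + 1) - (int u + 1)] (mod int n)"
      by (intro cong_diff cong_refl s)
    finally show "int n dvd 2 * int (?s u) - int u - int (?s (?s u))"
      by (simp add: cong_0_iff)
  qed
  then have "int n dvd weight F"
    using weighted_sum_cycle_laplacian[OF n z, of int] F by (simp add: weight_def flip: Fz)
  ultimately show "degree F = 0 \<and> int n dvd weight F" ..
next
  assume *: "degree F = 0 \<and> int n dvd weight F"
  then obtain c where c: "weight F = int n * c"
    by blast
  \<comment> \<open>\<open>z\<close> is the discrete double antiderivative of \<open>- F\<close> with slope chosen so that \<open>z n = z 0\<close>.\<close>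
  define z where "z x = - c * int x - (\<Sum>m<x. (int x - int m) * F $ m)" for x
  have z0: "z 0 = 0"
    by (simp add: z_def)
  have z_Suc: "z (Suc x) = z x - c - (\<Sum>m<Suc x. F $ m)" for x
    by (simp add: z_def algebra_simps sum.distrib sum_subtractf)
  have "z n = - c * int n - (int n * degree F - weight F)"
    using F by (simp add: z_def degree_def weight_def left_diff_distrib sum_subtractf sum_distrib_left)
  then have zn: "z n = 0"
    using * c by simp
  \<comment> \<open>Since \<open>z n = z 0\<close>, the function \<open>z\<close> on the integer
    line closes up to a function on the cycle.\<close>
  have z_mod: "z (Suc u mod n) = z (Suc u)" if "u < n" for u
    using that z0 zn by (auto simp: mod_Suc)
  have "F = cycle_laplacian n *\<^sub>v vec n z"
  proof (rule eq_vecI)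
    fix u assume "u < dim_vec (cycle_laplacian n *\<^sub>v vec n z)"
    then have u: "u < n"
      by (simp add: cycle_laplacian_def laplacian_def)
    have "(cycle_laplacian n *\<^sub>v vec n z) $ u =
        2 * z u - z (Suc u) - z (if u = 0 then n - 1 else u - 1)"
      using u by (subst cycle_laplacian_mult_index) (auto simp: z_mod)
    also have "\<dots> = F $ u"
    proof (cases u)
      case 0
      \<comment> \<open>Row 0 is the one whose predecessor wraps around: \<open>z n = 0\<close> and
        \<open>degree F = 0\<close> force \<open>z (n - 1) = c\<close>, which cancels the slope in
        \<open>z 1\<close>.\<close>
      have "z n = z (n - 1) - c - degree F"
        using z_Suc[of "n - 1"] n F by (simp add: degree_def)
      then show ?thesis
        using 0 zn * z_Suc[of 0] z0 by simp
    next
      case (Suc v)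
      then show ?thesis
        using z_Suc[of u] z_Suc[of v] by simp
    qed
    finally show "F $ u = (cycle_laplacian n *\<^sub>v vec n z) $ u" ..
  qed (use F in \<open>simp add: cycle_laplacian_def laplacian_def\<close>)
  then show "F \<in> (\<lambda>z. cycle_laplacian n *\<^sub>v z) ` carrier_vec n"
    by (intro image_eqI[where x = "vec n z"]) auto
qed

lemma linear_system_eq:
  assumes n: "n \<ge> 1" and D: "D \<in> carrier_vec n"
  shows "linear_system n D =
    {E \<in> carrier_vec n. 0\<^sub>v n \<le> E \<and> degree E = degree D \<and> [weight E = weight D] (mod int n)}"
proof -
  have "lin_equiv n E D \<longleftrightarrow> degree E = degree D \<and> [weight E = weight D] (mod int n)"
    if E: "E \<in> carrier_vec n" for E
  proof -
    have "degree (E - D) = degree E - degree D" "weight (E - D) = weight E - weight D"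
      using E D by (simp_all add: degree_def weight_def sum_subtractf right_diff_distrib)
    then show ?thesis
      unfolding lin_equiv_def using cycle_laplacian_image_iff[OF n, of "E - D"] E D
      by (simp add: cong_iff_dvd_diff)
  qed
  then show ?thesis
    by (auto simp: linear_system_def)
qed


section \<open>Words beginning with a black bead\<close>

text \<open>Lists replace vectors here so that \<open>rotate\<close> and list induction are
  available.\<close>

definition bead_word :: "nat list \<Rightarrow> bead list" where
  "bead_word xs = concat (map (\<lambda>a. Black # replicate a White) xs)"

lemma bead_word_simps [simp]:
  "bead_word [] = []"
  "bead_word (a # xs) = Black # replicate a White @ bead_word xs"
  "bead_word (xs @ ys) = bead_word xs @ bead_word ys"
  by (simp_all add: bead_word_def)

lemma bead_word_eq_Nil_iff [simp]: "bead_word xs = [] \<longleftrightarrow> xs = []"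
  by (cases xs) auto

lemma count_list_replicate: "count_list (replicate a x) y = (if x = y then a else 0)"
  by (induction a) auto

lemma count_bead_word:
  "count_list (bead_word xs) Black = length xs"
  "count_list (bead_word xs) White = sum_list xs"
  by (induction xs) (auto simp: count_list_replicate)

text \<open>A \<open>bead_word\<close> is empty or starts with a black bead, so the prefix is
  exactly the maximal leading run of white beads.\<close>

lemma replicate_White_append_bead_word_inject:
  "replicate a White @ bead_word xs = replicate b White @ bead_word ys \<longleftrightarrow> a = b \<and> bead_word xs = bead_word ys"
proof (induction a arbitrary: b)
  case 0
  then show ?case by (cases b; cases xs) auto
next
  case (Suc a)
  then show ?case by (cases b; cases ys) auto
qed

lemma bead_word_inject: "bead_word xs = bead_word ys \<longleftrightarrow> xs = ys"
proof (induction xs arbitrary: ys)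
  case Nil
  then show ?case by (cases ys) auto
next
  case (Cons a xs)
  then show ?case
    by (cases ys) (auto simp: replicate_White_append_bead_word_inject)
qed

lemma ex_replicate_White_append_bead_word: "\<exists>a xs. u = replicate a White @ bead_word xs"
proof (induction u)
  case Nil
  show ?case by (rule exI[of _ 0], rule exI[of _ "[]"]) simp
next
  case (Cons b u)
  then obtain a xs where u: "u = replicate a White @ bead_word xs"
    by blast
  show ?case
  proof (cases b)
    case Black
    then show ?thesis
      by (intro exI[of _ 0] exI[of _ "a # xs"]) (simp add: u)
  next
    case White
    then show ?thesis
      by (intro exI[of _ "Suc a"] exI[of _ xs]) (simp add: u)
  qed
qed

text \<open>The white beads before the first black one are rotated to the end, where they lengthen
  the last white run.\<close>

lemma ex_rotate_eq_bead_word: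
  assumes "Black \<in> set u"
  shows "\<exists>m xs. rotate m u = bead_word xs"
proof -
  obtain a xs where u: "u = replicate a White @ bead_word xs"
    using ex_replicate_White_append_bead_word by blast
  then have "xs \<noteq> []"
    using assms by auto
  then obtain ys y where xs: "xs = ys @ [y]"
    by (cases xs rule: rev_cases) auto
  have "rotate a u = bead_word xs @ replicate a White"
    using rotate_append[of "replicate a White" "bead_word xs"] by (simp add: u)
  also have "\<dots> = bead_word (ys @ [y + a])"
    by (simp add: xs replicate_add)
  finally show ?thesis
    by blast
qed

text \<open>Moving one whole block, a black bead with its \<open>a\<close> white ones, is a single
  rotation step of the list of run lengths.\<close>

lemma rotate_bead_word_Cons:
  "rotate (Suc a) (bead_word (a # xs)) = bead_word (rotate1 (a # xs))"
  using rotate_append[of "Black # replicate a White" "bead_word xs"] by simp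

lemma ex_rotate_bead_word: "\<exists>m. bead_word (rotate p xs) = rotate m (bead_word xs)"
proof (induction p)
  case 0
  show ?case by (rule exI[of _ 0]) simp
next
  case (Suc p)
  then obtain m where m: "bead_word (rotate p xs) = rotate m (bead_word xs)"
    by blast
  show ?case
  proof (cases "rotate p xs")
    case Nil
    then show ?thesis using m by auto
  next
    case (Cons a ys)
    then have "bead_word (rotate (Suc p) xs) = rotate (Suc a) (bead_word (rotate p xs))"
      using rotate_bead_word_Cons[of a ys] by simp
    then show ?thesis
      by (metis m rotate_rotate)
  qed
qed

text \<open>By strong induction on \<open>m\<close>, whole blocks are rotated away one at a time. A
  rotation ending inside a block would yield a word that starts with a white bead.\<close>

lemma rotate_bead_word_imp_rotate:
  "rotate m (bead_word xs) = bead_word ys \<Longrightarrow> \<exists>p. ys = rotate p xs"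
proof (induction m arbitrary: xs rule: less_induct)
  case (less m)
  show ?case
  proof (cases "m = 0 \<or> xs = []")
    case True
    then show ?thesis
      using less.prems by (auto simp: bead_word_inject intro: exI[of _ 0] dest: sym)
  next
    case False
    then obtain a zs where xs: "xs = a # zs" and m: "m > 0"
      by (cases xs) auto
    show ?thesis
    proof (cases "Suc a \<le> m")
      case True
      have "rotate (m - Suc a) (bead_word (rotate1 xs)) = rotate m (bead_word xs)"
        unfolding xs rotate_bead_word_Cons[symmetric] rotate_rotate using True by simp
      then obtain p where "ys = rotate p (rotate1 xs)"
        using less.IH[of "m - Suc a" "rotate1 xs"] less.prems m by auto
      then show ?thesis
        by (metis rotate1_rotate_swap rotate_Suc)
    next
      case False
      \<comment> \<open>Now \<open>0 < m \<le> a\<close>: the cut falls inside the first block and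
        leaves \<open>Suc a - m > 0\<close> white beads in front.\<close>
      have "bead_word xs = (Black # replicate (m - 1) White) @ (replicate (Suc a - m) White @ bead_word zs)"
        using False m by (simp add: xs replicate_add[symmetric] flip: append_assoc)
      then have "rotate m (bead_word xs) =
          (replicate (Suc a - m) White @ bead_word zs) @ Black # replicate (m - 1) White"
        using rotate_append[of "Black # replicate (m - 1) White"
          "replicate (Suc a - m) White @ bead_word zs"] m by simp
      moreover have "Suc a - m > 0"
        using False by simp
      ultimately have "hd (bead_word ys) = White" "ys \<noteq> []"
        using less.prems by (cases "Suc a - m"; auto)+
      then show ?thesis
        by (cases ys) auto
    qed
  qed
qed

section \<open>Necklaces as rotation classes of lists of run lengths\<close>

lemma equiv_cyclic_shift_rel: "equiv UNIV cyclic_shift_rel"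
proof (rule equivI)
  show "refl cyclic_shift_rel"
    by (auto simp: refl_on_def cyclic_shift_rel_def intro: exI[of _ 0])
  show "sym cyclic_shift_rel"
  proof (rule symI)
    fix u v assume "(u, v) \<in> cyclic_shift_rel"
    then obtain m where v: "v = rotate m u"
      by (auto simp: cyclic_shift_rel_def)
    \<comment> \<open>Completing the shift by \<open>m\<close> to a multiple of the length undoes
      it. The subtraction truncates only for empty \<open>u\<close>, where every rotation is
      trivial.\<close>
    have "rotate (length u * m - m) v = rotate (length u * m) u"
      by (cases u) (simp_all add: v rotate_rotate add.commute del: rotate_id)
    also have "\<dots> = u"
      by (simp add: rotate_id)
    finally show "(v, u) \<in> cyclic_shift_rel"
      by (auto simp: cyclic_shift_rel_def intro: sym)
  qed
  show "trans cyclic_shift_rel"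
    by (auto simp: trans_def cyclic_shift_rel_def rotate_rotate)
qed auto

lemma necklace_eq_iff: "necklace u = necklace v \<longleftrightarrow> (\<exists>m. v = rotate m u)"
  using eq_equiv_class_iff[OF equiv_cyclic_shift_rel, of u v]
  by (simp add: necklace_def cyclic_shift_rel_def)

lemma necklace_bead_word_eq_iff:
  "necklace (bead_word xs) = necklace (bead_word ys) \<longleftrightarrow> (\<exists>p. ys = rotate p xs)"
  unfolding necklace_eq_iff
  using rotate_bead_word_imp_rotate ex_rotate_bead_word by metis

lemma count_list_rotate1: "count_list (rotate1 u) x = count_list u x"
  by (cases u) auto

lemma count_list_rotate: "count_list (rotate m u) x = count_list u x"
  by (induction m) (simp_all add: count_list_rotate1)

text \<open>As \<open>n \<ge> 1\<close>, every word in the class has a black bead and can be rotated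
  to start with one.\<close>

lemma necklaces_eq:
  assumes "n \<ge> 1"
  shows "necklaces n k = (\<lambda>xs. necklace (bead_word xs)) ` {xs. length xs = n \<and> sum_list xs = k}"
proof (intro equalityI subsetI)
  fix N assume "N \<in> necklaces n k"
  then obtain u where u: "count_list u Black = n" "count_list u White = k" "N = necklace u"
    by (auto simp: necklaces_def necklace_def elim: quotientE)
  then have "Black \<in> set u"
    using assms by (metis count_list_0_iff not_one_le_zero)
  then obtain m xs where xs: "rotate m u = bead_word xs"
    using ex_rotate_eq_bead_word by blast
  then have "N = necklace (bead_word xs)"
    unfolding u(3) necklace_eq_iff by metis
  moreover have "length xs = n" "sum_list xs = k"
    using u(1,2) xs by (metis count_list_rotate count_bead_word)+
  ultimately show "N \<in> (\<lambda>xs. necklace (bead_word xs)) ` {xs. length xs = n \<and> sum_list xs = k}"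
    by blast
next
  fix N assume "N \<in> (\<lambda>xs. necklace (bead_word xs)) ` {xs. length xs = n \<and> sum_list xs = k}"
  then show "N \<in> necklaces n k"
    by (auto simp: necklaces_def necklace_def count_bead_word intro!: quotientI)
qed


section \<open>Rotating an effective divisor\<close>

definition list_weight :: "nat list \<Rightarrow> int" where
  "list_weight xs = (\<Sum>i<length xs. int i * int (xs ! i))"

text \<open>Every entry but the first moves down one index. The first moves from index 0 to
  \<open>length xs - 1\<close>, which is -1 modulo the length, so it too is subtracted once.\<close>

lemma list_weight_rotate1:
  "[list_weight (rotate1 xs) = list_weight xs - int (sum_list xs)] (mod int (length xs))"
proof (cases xs)
  case Nil
  then show ?thesis by (simp add: list_weight_def)
next
  case (Cons x ys)
  have "list_weight (x # ys) = list_weight ys + int (sum_list ys)"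
    by (simp add: list_weight_def sum.lessThan_Suc_shift sum_list_sum_nth atLeast0LessThan
        distrib_right sum.distrib del: sum.lessThan_Suc)
  moreover have "list_weight (ys @ [x]) = list_weight ys + int (length ys) * int x"
    by (simp add: list_weight_def nth_append)
  ultimately have "list_weight (rotate1 xs) =
      list_weight xs - int (sum_list xs) + int (length xs) * int x"
    by (simp add: Cons algebra_simps)
  then show ?thesis
    by (simp add: cong_iff_dvd_diff)
qed

lemma sum_list_rotate: "sum_list (rotate p xs) = sum_list (xs :: 'a :: comm_monoid_add list)"
proof (induction p)
  case (Suc p)
  have "sum_list (rotate1 ys) = sum_list ys" for ys :: "'a list"
    by (cases ys) (simp_all add: add.commute)
  then show ?case
    using Suc by simp
qed simp

lemma list_weight_rotate:
  "[list_weight (rotate p xs) = list_weight xs - int p * int (sum_list xs)] (mod int (length xs))"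
proof (induction p)
  case 0
  show ?case by simp
next
  case (Suc p)
  have "[list_weight (rotate (Suc p) xs) = list_weight (rotate p xs) - int (sum_list xs)] (mod int (length xs))"
    using list_weight_rotate1[of "rotate p xs"] by (simp add: sum_list_rotate)
  also have "[list_weight (rotate p xs) - int (sum_list xs)
      = list_weight xs - int p * int (sum_list xs) - int (sum_list xs)] (mod int (length xs))"
    by (intro cong_diff Suc.IH cong_refl)
  finally show ?case
    by (simp add: algebra_simps)
qed

text \<open>Rotation by \<open>p\<close> lowers the weight by \<open>p * k\<close> modulo
  \<open>n\<close>. As \<open>k\<close> is a unit, a rotation orbit reaches every residue
  \<open>c\<close>, and two rotations reach the same one only if they differ by a multiple of
  \<open>n\<close>.\<close>

lemma bij_betw_necklaces:
  assumes n: "n \<ge> 1" and coprime: "coprime n k"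
  shows "bij_betw (\<lambda>xs. necklace (bead_word xs))
    {xs. length xs = n \<and> sum_list xs = k \<and> [list_weight xs = c] (mod int n)} (necklaces n k)"
    (is "bij_betw ?f ?A _")
proof (rule bij_betw_imageI)
  show "inj_on ?f ?A"
  proof (rule inj_onI)
    fix xs ys assume xs: "xs \<in> ?A" and ys: "ys \<in> ?A" and "?f xs = ?f ys"
    then obtain p where p: "ys = rotate p xs"
      by (auto simp: necklace_bead_word_eq_iff)
    have "[list_weight xs = list_weight ys] (mod int n)"
      using xs ys by (auto intro: cong_trans cong_sym)
    also have "[list_weight ys = list_weight xs - int p * int k] (mod int n)"
      using list_weight_rotate[of p xs] xs p by simp
    finally have "int n dvd int (p * k)"
      by (simp add: cong_iff_dvd_diff)
    then have "n dvd p"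
      using coprime by (simp only: int_dvd_int_iff coprime_dvd_mult_left_iff)
    then show "xs = ys"
      using xs p by (simp add: rotate_id mod_eq_0_iff_dvd)
  qed
  show "?f ` ?A = necklaces n k"
  proof
    show "?f ` ?A \<subseteq> necklaces n k"
      unfolding necklaces_eq[OF n] by blast
    show "necklaces n k \<subseteq> ?f ` ?A"
    proof
      fix N assume "N \<in> necklaces n k"
      then obtain xs where xs: "length xs = n" "sum_list xs = k" "N = ?f xs"
        unfolding necklaces_eq[OF n] by blast
      obtain y where y: "[int k * y = 1] (mod int n)"
        using coprime cong_solve_coprime_int[of "int k" "int n"] by (auto simp: coprime_commute)
      \<comment> \<open>With \<open>y\<close> the inverse of \<open>k\<close>, this solves
        \<open>p * k = list_weight xs - c\<close> modulo \<open>n\<close>; reducing modulo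
        \<open>n\<close> makes \<open>p\<close> a natural number.\<close>
      define p where "p = nat ((list_weight xs - c) * y mod int n)"
      have p: "int p = (list_weight xs - c) * y mod int n"
        using n by (simp add: p_def)
      have "[int p * int k = (list_weight xs - c) * y * int k] (mod int n)"
        unfolding p by (simp add: cong_def mod_mult_left_eq)
      also have "[(list_weight xs - c) * y * int k = (list_weight xs - c) * 1] (mod int n)"
        using cong_scalar_left[OF y, of "list_weight xs - c"] by (simp add: ac_simps)
      finally have "[list_weight xs - int p * int k = list_weight xs - (list_weight xs - c) * 1] (mod int n)"
        by (intro cong_diff cong_refl)
      then have "[list_weight (rotate p xs) = c] (mod int n)"
        using list_weight_rotate[of p xs] xs by (auto intro: cong_trans)
      then have "rotate p xs \<in> ?A"
        using xs by (simp add: sum_list_rotate)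
      moreover have "N = ?f (rotate p xs)"
        unfolding xs(3) necklace_bead_word_eq_iff by blast
      ultimately show "N \<in> ?f ` ?A"
        by blast
    qed
  qed
qed

section \<open>Transfer from effective divisors to lists of natural numbers\<close>

definition divisor_list :: "int vec \<Rightarrow> nat list" where
  "divisor_list E = map (\<lambda>i. nat (E $ i)) [0..<dim_vec E]"

lemma divisor_word_eq: "divisor_word E = bead_word (divisor_list E)"
  by (simp add: divisor_word_def bead_word_def divisor_list_def comp_def)

text \<open>On effective divisors \<open>nat\<close> loses no information, so degree and weight
  carry over to \<open>sum_list\<close> and \<open>list_weight\<close>.\<close>

lemma bij_betw_divisor_list:
  "bij_betw divisor_list
    {E \<in> carrier_vec n. 0\<^sub>v n \<le> E \<and> degree E = int k \<and> [weight E = c] (mod int n)}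
    {xs. length xs = n \<and> sum_list xs = k \<and> [list_weight xs = c] (mod int n)}"
proof -
  have degree: "degree E = int (sum_list (divisor_list E))"
    and weight: "weight E = list_weight (divisor_list E)"
    if "E \<in> carrier_vec n" "0\<^sub>v n \<le> E" for E
    using that
    by (auto simp: degree_def weight_def list_weight_def divisor_list_def less_eq_vec_def
        sum_list_sum_nth atLeast0LessThan intro!: sum.cong)
  let ?g = "\<lambda>xs. vec (length xs) (\<lambda>i. int (xs ! i))"
  have list_vec: "divisor_list (?g xs) = xs" for xs
    by (auto simp: divisor_list_def intro: nth_equalityI)
  have nonneg: "0\<^sub>v n \<le> ?g xs" if "length xs = n" for xs
    using that by (simp add: less_eq_vec_def)
  show ?thesis
  proof (rule bij_betw_byWitness[where f' = ?g])
    show "\<forall>E\<in>{E \<in> carrier_vec n. 0\<^sub>v n \<le> E \<and> degree E = int k \<and> [weight E = c] (mod int n)}.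
        ?g (divisor_list E) = E"
      by (auto simp: divisor_list_def less_eq_vec_def intro!: eq_vecI)
  qed (use degree weight nonneg list_vec in \<open>auto simp: divisor_list_def\<close>)
qed

theorem theorem6p7:
  fixes n k j :: nat and q D\<^sub>j :: "int vec"
  assumes "n \<ge> 1" and "gcd n k = 1" and "j \<in> {1..n}"
    and "q = vertex_divisor n n"
    and "D\<^sub>j = vertex_divisor n j - q"
  shows "bij_betw divisor_necklace (linear_system n (D\<^sub>j + int k \<cdot>\<^sub>v q)) (necklaces n k)"
proof -
  let ?D = "D\<^sub>j + int k \<cdot>\<^sub>v q"
  have D: "?D \<in> carrier_vec n"
    using assms(4,5) by (simp add: vertex_divisor_def)
  have dim: "dim_vec (vertex_divisor n i) = n" for i
    by (simp add: vertex_divisor_def)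
  have degree_vertex: "(\<Sum>i<n. vertex_divisor n i' $ i) = 1" if "i' \<in> {1..n}" for i'
    using that by (auto simp: vertex_divisor_def unit_vec_def)
  have "degree ?D = (\<Sum>i<n. vertex_divisor n j $ i) - (\<Sum>i<n. vertex_divisor n n $ i)
      + int k * (\<Sum>i<n. vertex_divisor n n $ i)"
    using assms(4,5)
    by (simp add: degree_def dim sum.distrib sum_subtractf sum_distrib_left)
  then have "degree ?D = int k"
    using degree_vertex assms(1,3) by simp
  \<comment> \<open>The degree is \<open>1 - 1 + k\<close>, and \<open>j\<close> enters through the
    residue of \<open>weight ?D\<close>, which is taken as the class \<open>c\<close>.\<close>
  then have "bij_betw divisor_list (linear_system n ?D)
      {xs. length xs = n \<and> sum_list xs = k \<and> [list_weight xs = weight ?D] (mod int n)}"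
    using bij_betw_divisor_list[of n k "weight ?D"] linear_system_eq[OF assms(1) D] by simp
  moreover have "bij_betw (\<lambda>xs. necklace (bead_word xs))
      {xs. length xs = n \<and> sum_list xs = k \<and> [list_weight xs = weight ?D] (mod int n)} (necklaces n k)"
    using assms(1,2) by (intro bij_betw_necklaces) (simp_all add: coprime_iff_gcd_eq_1)
  ultimately have "bij_betw ((\<lambda>xs. necklace (bead_word xs)) \<circ> divisor_list)
      (linear_system n ?D) (necklaces n k)"
    by (rule bij_betw_trans)
  moreover have "(\<lambda>xs. necklace (bead_word xs)) \<circ> divisor_list = divisor_necklace"
    by (simp add: fun_eq_iff divisor_necklace_def divisor_word_eq)
  ultimately show ?thesis
    by simp
qed

end
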